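(* Let $\alpha\in(1,2]$, $\sigma>0$, $u>0$, $S>0$, $0<K_-<K_+$, $r\in\mathbb{R}$, $\tau>0$, let $X_t\sim L(0,\sigma^\alpha,-1)$, and put $\mu=\sigma^\alpha/\cos\frac{\pi\alpha}{2}$ and $k_u^{\pm}:=\log\frac{S}{K_\pm^{1/u}}+r\tau$. The value of the capped power cash-or-nothing call option, i.e. the option with payoff $\mathcal{P}^{(C/N,cap)}(S_T,K_+,K_-)=\mathbf{1}_{\{K_-<S_T^u<K_+\}}$, is $$C_\alpha^{(C/N,cap)}(S,K_+,K_-,r,\mu,\tau)=\frac{e^{-r\tau}}{\alpha}\sum_{n=0}^\infty\frac{1}{n!\,\Gamma\left(1-\frac{n}{\alpha}\right)}\left((k_u^-+\mu\tau)^n-(k_u^++\mu\tau)^n\right)(-\mu\tau)^{-\frac{n}{\alpha}}.$$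
   Context: The process $X_t\sim L(0,\sigma^\alpha,-1)$ is the spectrally negative $\alpha$-stable Lévy process with characteristic function $\mathbb{E}[e^{ikX_t}]=\exp\left(-t\,\sigma^\alpha|k|^\alpha\left(1+i\tan\frac{\alpha\pi}{2}\,\mathrm{sgn}\,k\right)\right)$ for $k\in\mathbb{R}$; equivalently $\mathbb{E}[e^{pX_t}]=e^{-\mu t p^\alpha}$ for $p>0$, with $\mu=\sigma^\alpha/\cos\frac{\pi\alpha}{2}<0$. The asset price at maturity is $S_T=S\,e^{(r+\mu)\tau+X_\tau}$, where $\tau$ is the time-to-maturity, and the value of an option with payoff $\mathcal{P}(S_T,K_+,K_-)$ is $e^{-r\tau}\,\mathbb{E}\left[\mathcal{P}\left(Se^{(r+\mu)\tau+X_\tau},K_+,K_-\right)\right]$. Conventions: $1/\Gamma(z)=0$ when $z$ is a non-positive integer, and $0^0=1$. *)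

theory Defs
  imports "HOL-Probability.Probability"
begin

text \<open>Processes are functions of type \<^typ>\<open>real \<Rightarrow> 'a \<Rightarrow> real\<close> of which only the times
  \<open>t \<ge> 0\<close> matter.\<close>

definition levy_process :: "'a measure \<Rightarrow> (real \<Rightarrow> 'a \<Rightarrow> real) \<Rightarrow> bool" where
  "levy_process M X \<longleftrightarrow>
     prob_space M \<and>
     (\<forall>t\<ge>0. X t \<in> borel_measurable M) \<and>
     (AE \<omega> in M. X 0 \<omega> = 0) \<and>
     (\<forall>(n::nat) t. 0 \<le> t 0 \<and> strict_mono_on {..n} t \<longrightarrow>
        prob_space.indep_vars M (\<lambda>_. borel) (\<lambda>i \<omega>. X (t (Suc i)) \<omega> - X (t i) \<omega>) {..<n}) \<and>
     (\<forall>s\<ge>0. \<forall>h\<ge>0. distr M borel (\<lambda>\<omega>. X (s + h) \<omega> - X s \<omega>) = distr M borel (X h)) \<and>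
     (\<forall>t\<ge>0. \<forall>\<epsilon>>0.
        ((\<lambda>s. measure M {\<omega> \<in> space M. \<bar>X s \<omega> - X t \<omega>\<bar> > \<epsilon>}) \<longlongrightarrow> 0) (at t within {0..})) \<and>
     (AE \<omega> in M. \<forall>t\<ge>0.
        ((\<lambda>s. X s \<omega>) \<longlongrightarrow> X t \<omega>) (at_right t) \<and>
        (t > 0 \<longrightarrow> (\<exists>l. ((\<lambda>s. X s \<omega>) \<longlongrightarrow> l) (at_left t))))"

text \<open>\<open>X\<^sub>t \<sim> L(0, \<sigma>\<^sup>\<alpha>, -1)\<close>: location 0, and skewness \<open>-1\<close> (no positive jumps).
  For \<open>\<alpha> = 2\<close> the tangent vanishes and \<open>X\<^sub>t\<close> is Gaussian with variance \<open>2\<sigma>\<^sup>2t\<close>.\<close>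

definition spectrally_negative_stable ::
  "'a measure \<Rightarrow> real \<Rightarrow> real \<Rightarrow> (real \<Rightarrow> 'a \<Rightarrow> real) \<Rightarrow> bool" where
  "spectrally_negative_stable M \<alpha> \<sigma> X \<longleftrightarrow>
     levy_process M X \<and>
     (\<forall>t\<ge>0. \<forall>k::real. char (distr M borel (X t)) k =
        exp (- of_real (t * \<sigma> powr \<alpha> * \<bar>k\<bar> powr \<alpha>) *
               (1 + \<i> * of_real (tan (\<alpha> * pi / 2) * sgn k))))"

definition stable_mu :: "real \<Rightarrow> real \<Rightarrow> real" where
  "stable_mu \<alpha> \<sigma> = \<sigma> powr \<alpha> / cos (pi * \<alpha> / 2)"

definition asset_price ::
  "(real \<Rightarrow> 'a \<Rightarrow> real) \<Rightarrow> real \<Rightarrow> real \<Rightarrow> real \<Rightarrow> real \<Rightarrow> 'a \<Rightarrow> real" where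
  "asset_price X S r \<mu> \<tau> \<omega> = S * exp ((r + \<mu>) * \<tau> + X \<tau> \<omega>)"

text \<open>Strikes are passed to a payoff in the order \<open>K\<^sub>+\<close>, \<open>K\<^sub>-\<close>.\<close>

definition option_value ::
  "'a measure \<Rightarrow> (real \<Rightarrow> 'a \<Rightarrow> real) \<Rightarrow> (real \<Rightarrow> real \<Rightarrow> real \<Rightarrow> real) \<Rightarrow>
   real \<Rightarrow> real \<Rightarrow> real \<Rightarrow> real \<Rightarrow> real \<Rightarrow> real \<Rightarrow> real" where
  "option_value M X P S Kp Km r \<mu> \<tau> =
     exp (- r * \<tau>) * (\<integral>\<omega>. P (asset_price X S r \<mu> \<tau> \<omega>) Kp Km \<partial>M)"

definition capped_power_CN_payoff :: "real \<Rightarrow> real \<Rightarrow> real \<Rightarrow> real \<Rightarrow> real" where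
  "capped_power_CN_payoff u s Kp Km = of_bool (Km < s powr u \<and> s powr u < Kp)"

definition log_moneyness :: "real \<Rightarrow> real \<Rightarrow> real \<Rightarrow> real \<Rightarrow> real \<Rightarrow> real" where
  "log_moneyness u S K r \<tau> = ln (S / K powr (1 / u)) + r * \<tau>"

text \<open>The reciprocal \<open>1 / \<Gamma>\<close> is \<^const>\<open>rGamma\<close>, which vanishes at the non-positive integers.\<close>

definition capped_CN_series_term ::
  "real \<Rightarrow> real \<Rightarrow> real \<Rightarrow> real \<Rightarrow> real \<Rightarrow> nat \<Rightarrow> real" where
  "capped_CN_series_term \<alpha> \<mu> \<tau> kp km n =
     1 / fact n * rGamma (1 - real n / \<alpha>) *
     ((km + \<mu> * \<tau>) ^ n - (kp + \<mu> * \<tau>) ^ n) * (- \<mu> * \<tau>) powr (- (real n / \<alpha>))"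

end

theory Submission
  imports Defs
begin

text \<open>The payoff is the indicator of \<open>a < X\<^sub>\<tau> < b\<close> with \<open>a = - (k\<^sub>u\<^sup>- + \<mu>\<tau>)\<close> and
  \<open>b = - (k\<^sub>u\<^sup>+ + \<mu>\<tau>)\<close>. The characteristic function \<open>\<phi>\<close> of \<open>X\<^sub>\<tau>\<close> is integrable, so the law
  has no atoms and Levy's inversion formula gives the probability as an absolutely convergent
  integral of \<open>(e\<^sup>-\<^sup>i\<^sup>t\<^sup>a - e\<^sup>-\<^sup>i\<^sup>t\<^sup>b) / (i t) \<phi>(t)\<close>. Expanding the quotient in powers of \<open>i t\<close> and
  integrating termwise is justified because \<open>|\<phi>(t)|\<close> decays like \<open>exp (- \<gamma> |t|\<^sup>\<alpha>)\<close> with \<open>\<alpha> > 1\<close>. Each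
  moment of \<open>\<phi>\<close> is a Gamma integral with complex rate, and the reflection formula turns
  \<open>\<Gamma>(s) sin (\<pi> s)\<close>, \<open>s = (m + 1) / \<alpha>\<close>, into the coefficient \<open>\<pi> / \<Gamma>(1 - s)\<close>.\<close>

section \<open>Gamma integrals with a real or complex rate\<close>

text \<open>Substituting v = a t^\<alpha> in Euler's integral for \<open>Gamma s\<close> turns
  v^(s-1) dv into a multiple of t^p dt, precisely because \<alpha> s = p + 1.\<close>

lemma has_bochner_integral_powr_exp_powr:
  fixes p a \<alpha> :: real
  assumes p: "p > -1" and a: "a > 0" and \<alpha>: "\<alpha> > 0"
  defines "s \<equiv> (p + 1) / \<alpha>"
  shows "has_bochner_integral lborel (\<lambda>t. indicator {0<..} t * (t powr p * exp (- a * t powr \<alpha>)))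
    (Gamma s / \<alpha> * a powr (- s))"
proof -
  have s: "s > 0" using p \<alpha> by (simp add: s_def)
  define g where "g = (\<lambda>t::real. a * t powr \<alpha>)"
  define f where "f = (\<lambda>v::real. v powr (s - 1) * exp (- v))"
  have "((\<lambda>v. v powr (s - 1) / exp v) has_integral Gamma s) {0..}"
    by (rule Gamma_integral_real[OF s])
  also have "(\<lambda>v. v powr (s - 1) / exp v) = f"
    by (simp add: f_def exp_minus field_simps fun_eq_iff)
  \<comment> \<open>The negligible point 0 is dropped, since the substitution is carried out on the
    open half-line.\<close>
  finally have "(f has_integral Gamma s) {0<..}"
    by (subst (asm) has_integral_spike_set_eq[where T="{0<..}"])
       (auto intro: negligible_subset[of "{0}"])
  then have f: "f absolutely_integrable_on {0<..}" "integral {0<..} f = Gamma s"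
    by (auto intro!: nonnegative_absolutely_integrable_1 simp: f_def)
  have img: "g ` {0<..} = {0<..}"
  proof safe
    fix v :: real assume "v > 0"
    then have "v = g ((v / a) powr (1 / \<alpha>))" "(v / a) powr (1 / \<alpha>) \<in> {0<..}"
      using a \<alpha> by (auto simp: g_def powr_powr)
    then show "v \<in> g ` {0<..}" by blast
  qed (use a in \<open>auto simp: g_def\<close>)
  have inj: "inj_on g {0<..}"
  proof (rule inj_onI)
    fix x y assume "x \<in> {0<..}" "y \<in> {0<..}" "g x = g y"
    then have "(x powr \<alpha>) powr (1 / \<alpha>) = (y powr \<alpha>) powr (1 / \<alpha>)" and "x > 0" "y > 0"
      using a by (simp_all add: g_def)
    then show "x = y"
      using \<alpha> by (simp add: powr_powr)
  qed
  have der: "(g has_field_derivative a * (\<alpha> * t powr (\<alpha> - 1))) (at t within {0<..})" if "t \<in> {0<..}" for t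
    using that by (auto simp: g_def intro!: derivative_eq_intros)
  have eq: "\<bar>a * (\<alpha> * t powr (\<alpha> - 1))\<bar> * f (g t) =
      (\<alpha> * a powr s) * (t powr p * exp (- a * t powr \<alpha>))" if "t \<in> {0<..}" for t
  proof -
    have t: "t > 0" using that by simp
    have sum: "(\<alpha> - 1) + \<alpha> * (s - 1) = p"
      using \<alpha> by (simp add: s_def field_simps)
    have e1: "t powr p = t powr (\<alpha> - 1) * t powr (\<alpha> * (s - 1))"
      by (simp add: powr_add[symmetric] sum)
    have e2: "a powr s = a * a powr (s - 1)"
      using a by (simp add: powr_mult_base)
    have e3: "f (g t) = a powr (s - 1) * t powr (\<alpha> * (s - 1)) * exp (- a * t powr \<alpha>)"
      using t a by (simp add: f_def g_def powr_mult powr_powr)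
    have e4: "\<bar>a * (\<alpha> * t powr (\<alpha> - 1))\<bar> = a * (\<alpha> * t powr (\<alpha> - 1))"
      using a \<alpha> by simp
    show ?thesis
      unfolding e1 e2 e3 e4 by (simp only: mult_ac)
  qed
  have ci: "(\<lambda>t. \<bar>a * (\<alpha> * t powr (\<alpha> - 1))\<bar> * f (g t)) absolutely_integrable_on {0<..} \<and>
      integral {0<..} (\<lambda>t. \<bar>a * (\<alpha> * t powr (\<alpha> - 1))\<bar> * f (g t)) = Gamma s"
    using has_absolute_integral_change_of_variables_1'[of "{0<..}" g "\<lambda>t. a * (\<alpha> * t powr (\<alpha> - 1))" f "Gamma s"]
      f img inj der by simp
  then have "((\<lambda>t. \<bar>a * (\<alpha> * t powr (\<alpha> - 1))\<bar> * f (g t)) has_integral Gamma s) {0<..}"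
    by (metis set_lebesgue_integral_eq_integral(1) has_integral_integral)
  then have "((\<lambda>t. (\<alpha> * a powr s) * (t powr p * exp (- a * t powr \<alpha>))) has_integral Gamma s) {0<..}"
    using eq by (subst has_integral_cong[symmetric]) auto
  from has_integral_mult_right[OF this, of "inverse (\<alpha> * a powr s)"]
  have "((\<lambda>t. t powr p * exp (- a * t powr \<alpha>)) has_integral (Gamma s / \<alpha> * a powr (- s))) {0<..}"
    using a \<alpha> by (simp add: powr_minus field_simps)
  \<comment> \<open>The integrand is nonnegative, so its gauge integral also determines its Lebesgue
    integral.\<close>
  from nn_integral_has_integral_lebesgue[OF _ this]
  show ?thesis
    by (intro has_bochner_integral_nn_integral)
      (use s \<alpha> in \<open>auto simp: Gamma_real_pos less_imp_le nn_integral_set_ennreal mult.commute\<close>)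
qed

text \<open>Dominated convergence applied to partial sums: a single g bounding all partial sums of
  norms dominates every term and every partial sum at once.\<close>

lemma sums_integral_dominated:
  fixes f :: "nat \<Rightarrow> 'a \<Rightarrow> 'b::{banach, second_countable_topology}"
  assumes meas: "\<And>n. f n \<in> borel_measurable M" and g: "integrable M g"
    and bound: "\<And>N x. x \<in> space M \<Longrightarrow> (\<Sum>n<N. norm (f n x)) \<le> g x"
    and sums: "AE x in M. (\<lambda>n. f n x) sums F x" and F: "F \<in> borel_measurable M"
  shows "integrable M F" and "(\<lambda>n. integral\<^sup>L M (f n)) sums integral\<^sup>L M F"
proof -
  have int: "integrable M (f n)" for n
  proof (rule Bochner_Integration.integrable_bound[OF g meas], rule AE_I2)
    fix x assume x: "x \<in> space M"
    have "norm (f n x) \<le> (\<Sum>k<Suc n. norm (f k x))"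
      by (simp add: sum_nonneg)
    also have "\<dots> \<le> g x" by (rule bound[OF x])
    finally show "norm (f n x) \<le> norm (g x)" by simp
  qed
  have partial: "(\<lambda>x. \<Sum>n<N. f n x) \<in> borel_measurable M" for N
    using meas by measurable
  have lim: "AE x in M. (\<lambda>N. \<Sum>n<N. f n x) \<longlonglongrightarrow> F x"
    using sums by (simp add: sums_def)
  have le: "AE x in M. norm (\<Sum>n<N. f n x) \<le> g x" for N
    by (rule AE_I2) (rule order_trans[OF norm_sum bound])
  show "integrable M F"
    by (rule integrable_dominated_convergence[OF F partial g lim le])
  have "(\<lambda>N. integral\<^sup>L M (\<lambda>x. \<Sum>n<N. f n x)) \<longlonglongrightarrow> integral\<^sup>L M F"
    by (rule integral_dominated_convergence[OF F partial g lim le])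
  then show "(\<lambda>n. integral\<^sup>L M (f n)) sums integral\<^sup>L M F"
    by (simp add: sums_def int)
qed

lemma sum_power_fact_le_exp:
  fixes x :: real
  assumes "x \<ge> 0"
  shows "(\<Sum>n<N. x ^ n / fact n) \<le> exp x"
proof -
  have "(\<lambda>n. x ^ n / fact n) sums exp x"
    using exp_converges[of x] by (simp add: field_simps scaleR_conv_of_real)
  then show ?thesis
    using assms sum_le_suminf[of "\<lambda>n. x ^ n / fact n" "{..<N}"] by (simp add: sums_iff)
qed

text \<open>Both arguments lie strictly between -\<pi>/2 and \<pi>/2, so their sum stays in the
  principal range and the logarithms add without a jump of 2\<pi>.\<close>

lemma complex_powr_mult_Re_pos:
  fixes x y z :: complex
  assumes "Re x > 0" "Re y > 0"
  shows "(x * y) powr z = x powr z * y powr z"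
proof -
  have "\<bar>Im (Ln x)\<bar> < pi / 2" "\<bar>Im (Ln y)\<bar> < pi / 2"
    using assms Re_Ln_pos_lt_imp by auto
  moreover have "x \<noteq> 0" "y \<noteq> 0" using assms by auto
  ultimately show ?thesis
    by (simp add: powr_def Ln_times_simple exp_add[symmetric] algebra_simps)
qed

text \<open>The integral formula continues analytically in the rate: it passes from \<open>w\<close> to \<open>w + h\<close> by
  expanding \<open>exp (- h t\<^sup>\<alpha>)\<close> and summing the resulting binomial series.\<close>

lemma has_bochner_integral_powr_exp_step:
  fixes p \<alpha> :: real and w h :: complex
  assumes p: "p > -1" and \<alpha>: "\<alpha> > 0" and h: "norm h < Re w"
    and w: "\<And>p. p > -1 \<Longrightarrow> has_bochner_integral lborel
      (\<lambda>t. indicator {0<..} t *\<^sub>R (of_real (t powr p) * exp (- w * of_real (t powr \<alpha>))))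
      (of_real (Gamma ((p + 1) / \<alpha>) / \<alpha>) * w powr (- of_real ((p + 1) / \<alpha>)))"
  shows "has_bochner_integral lborel
    (\<lambda>t. indicator {0<..} t *\<^sub>R (of_real (t powr p) * exp (- (w + h) * of_real (t powr \<alpha>))))
    (of_real (Gamma ((p + 1) / \<alpha>) / \<alpha>) * (w + h) powr (- of_real ((p + 1) / \<alpha>)))"
    (is "has_bochner_integral _ ?F _")
proof -
  define s where "s = (p + 1) / \<alpha>"
  have s: "s > 0" using p \<alpha> by (simp add: s_def)
  have Rew: "Re w > 0" using h norm_ge_zero[of h] by linarith
  then have w0: "w \<noteq> 0" by auto
  define f :: "nat \<Rightarrow> real \<Rightarrow> complex" where "f = (\<lambda>n t. indicator {0<..} t *\<^sub>R
      (of_real (t powr p) * exp (- w * of_real (t powr \<alpha>)) * ((- h * of_real (t powr \<alpha>)) ^ n / fact n)))"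
  \<comment> \<open>The majorant: the norms of the expansion of exp (- h t^\<alpha>) sum to at most
    exp (|h| t^\<alpha>). Its rate Re w - |h| is positive by the hypothesis on h.\<close>
  define g where "g = (\<lambda>t. indicator {0<..} t * (t powr p * exp (- (Re w - norm h) * t powr \<alpha>)))"
  have g: "integrable lborel g"
    unfolding g_def using has_bochner_integral_powr_exp_powr[OF p _ \<alpha>] h
    by (meson diff_gt_0_iff_gt has_bochner_integral_iff)
  have fint: "has_bochner_integral lborel (f n)
     (of_real (Gamma s / \<alpha>) * w powr (- of_real s) * ((- of_real s gchoose n) * (h / w) ^ n))" for n
  proof -
    \<comment> \<open>The n-th term raises the exponent from p to p + \<alpha> n, which is why the
      formula at w is assumed for all exponents above -1.\<close>
    have eq: "f n = (\<lambda>t. (- h) ^ n / fact n *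
      indicator {0<..} t *\<^sub>R (of_real (t powr (p + \<alpha> * n)) * exp (- w * of_real (t powr \<alpha>))))"
    proof
      fix t :: real
      have "(- h * of_real (t powr \<alpha>)) ^ n = (- h) ^ n * of_real (t powr (\<alpha> * n))" if "t > 0"
        using that by (simp only: power_mult_distrib powr_powr[symmetric] powr_realpow powr_gt_zero of_real_power)
      then show "f n t = (- h) ^ n / fact n *
          indicator {0<..} t *\<^sub>R (of_real (t powr (p + \<alpha> * n)) * exp (- w * of_real (t powr \<alpha>)))"
        by (cases "t > 0") (simp_all only: f_def powr_add, simp_all)
    qed
    have p': "p + \<alpha> * n > -1" using p \<alpha> by (smt (verit) mult_nonneg_nonneg of_nat_0_le_iff)
    have s': "(p + \<alpha> * n + 1) / \<alpha> = s + n"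
      using \<alpha> by (simp add: s_def field_simps)
    have G: "Gamma (s + n) = pochhammer s n * Gamma s"
      using s pochhammer_Gamma[of s n] by (auto simp: nonpos_Ints_def Gamma_eq_zero_iff)
    have W: "w powr (- of_real (s + n)) = w powr (- of_real s) / w ^ n"
      using w0 by (simp add: powr_add powr_minus powr_nat' divide_inverse powr_diff)
    have B: "(- of_real s :: complex) gchoose n = (- 1) ^ n * of_real (pochhammer s n) / fact n"
      by (simp add: gbinomial_pochhammer pochhammer_of_real)
    \<comment> \<open>The shift of s by n produces a rising factorial of s; divided by n! and with
      its sign it is the binomial coefficient of -s, so a binomial series in h / w appears.\<close>
    have "(- h) ^ n / fact n * (of_real (Gamma (s + n) / \<alpha>) * w powr (- of_real (s + n))) =
       of_real (Gamma s / \<alpha>) * w powr (- of_real s) * ((- of_real s gchoose n) * (h / w) ^ n)"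
      unfolding G W B by (subst power_minus) (simp add: power_divide, simp only: mult_ac)
    with has_bochner_integral_mult_right[OF w[OF p', unfolded s'], of "(- h) ^ n / fact n"]
    show ?thesis unfolding eq by simp
  qed
  have swap: "(\<lambda>n. integral\<^sup>L lborel (f n)) sums integral\<^sup>L lborel ?F"
  proof (rule sums_integral_dominated(2)[OF _ g])
    fix N and t :: real
    show "(\<Sum>n<N. norm (f n t)) \<le> g t"
    proof (cases "t > 0")
      case True
      have "(\<Sum>n<N. norm (f n t)) =
          t powr p * exp (- Re w * t powr \<alpha>) * (\<Sum>n<N. (norm h * t powr \<alpha>) ^ n / fact n)"
        using True by (simp add: f_def norm_mult norm_divide norm_power sum_distrib_left)
      also have "\<dots> \<le> t powr p * exp (- Re w * t powr \<alpha>) * exp (norm h * t powr \<alpha>)"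
        by (intro mult_left_mono sum_power_fact_le_exp) auto
      also have "\<dots> = g t"
        using True by (simp add: g_def exp_add[symmetric] algebra_simps)
      finally show ?thesis .
    qed (simp add: f_def g_def)
  next
    show "AE t in lborel. (\<lambda>n. f n t) sums ?F t"
    proof (rule AE_I2)
      fix t :: real
      let ?x = "- h * of_real (t powr \<alpha>)"
      have "(\<lambda>n. ?x ^ n / fact n) sums exp ?x"
        using exp_converges[of ?x] by (simp add: field_simps scaleR_conv_of_real)
      from sums_mult[OF this, of "indicator {0<..} t *\<^sub>R (of_real (t powr p) * exp (- w * of_real (t powr \<alpha>)))"]
      show "(\<lambda>n. f n t) sums ?F t"
        by (simp add: f_def exp_add[symmetric] algebra_simps exp_diff exp_minus divide_simps)
    qed
  qed (auto simp: f_def)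
  have hw: "norm (h / w) < 1"
    using h complex_Re_le_cmod[of w] w0 by (simp add: norm_divide divide_simps)
  then have "(\<lambda>n. of_real (Gamma s / \<alpha>) * w powr (- of_real s) * ((- of_real s gchoose n) * (h / w) ^ n)) sums
      (of_real (Gamma s / \<alpha>) * w powr (- of_real s) * (1 + h / w) powr (- of_real s))"
    by (intro sums_mult gen_binomial_complex)
  then have series: "(\<lambda>n. integral\<^sup>L lborel (f n)) sums
      (of_real (Gamma s / \<alpha>) * w powr (- of_real s) * (1 + h / w) powr (- of_real s))"
    using fint by (simp add: has_bochner_integral_iff)
  have "integral\<^sup>L lborel ?F =
      of_real (Gamma s / \<alpha>) * (w powr (- of_real s) * (1 + h / w) powr (- of_real s))"
    using sums_unique2[OF swap series] by (simp only: mult.assoc)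
  \<comment> \<open>Since |h / w| < 1, the factor 1 + h / w lies in the right half-plane, as does w,
    so the principal powers multiply.\<close>
  also have "w powr (- of_real s) * (1 + h / w) powr (- of_real s) = (w * (1 + h / w)) powr (- of_real s)"
  proof (rule complex_powr_mult_Re_pos[symmetric])
    show "Re (1 + h / w) > 0"
      using hw abs_Re_le_cmod[of "h / w"] by simp
  qed (rule Rew)
  also have "w * (1 + h / w) = w + h"
    using w0 by (simp add: field_simps)
  finally have "integral\<^sup>L lborel ?F = of_real (Gamma s / \<alpha>) * (w + h) powr (- of_real s)" .
  moreover have "integrable lborel ?F"
  proof (rule Bochner_Integration.integrable_bound[OF g])
    show "AE t in lborel. norm (?F t) \<le> norm (g t)"
    proof (rule AE_I2)
      fix t :: real
      have "Re w - norm h \<le> Re (w + h)"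
        using abs_Re_le_cmod[of h] by simp
      from mult_right_mono[OF this, of "t powr \<alpha>"]
      have le: "exp (- Re (w + h) * t powr \<alpha>) \<le> exp (- (Re w - norm h) * t powr \<alpha>)"
        by (simp only: exp_le_cancel_iff mult_minus_left neg_le_iff_le powr_ge_zero)
      show "norm (?F t) \<le> norm (g t)"
      proof (cases "t > 0")
        case True
        then have "norm (?F t) = t powr p * exp (- Re (w + h) * t powr \<alpha>)"
          by (simp add: norm_mult)
        also have "\<dots> \<le> norm (g t)"
          using mult_left_mono[OF le, of "t powr p"] True by (simp only: g_def) simp
        finally show ?thesis .
      qed (simp add: g_def)
    qed
  qed auto
  ultimately show ?thesis
    by (simp add: has_bochner_integral_iff s_def)
qed

text \<open>The vertical segment from the real point Re w up or down to w is cut into N equal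
  pieces, each shorter than Re w. The real part is constant along it, so the continuation step
  applies N times, starting from the real formula.\<close>

lemma has_bochner_integral_powr_exp_complex:
  fixes p \<alpha> :: real and w :: complex
  assumes p: "p > -1" and \<alpha>: "\<alpha> > 0" and w: "Re w > 0"
  shows "has_bochner_integral lborel
    (\<lambda>t. indicator {0<..} t *\<^sub>R (of_real (t powr p) * exp (- w * of_real (t powr \<alpha>))))
    (of_real (Gamma ((p + 1) / \<alpha>) / \<alpha>) * w powr (- of_real ((p + 1) / \<alpha>)))"
proof -
  obtain N :: nat where N: "\<bar>Im w\<bar> / Re w < N"
    using reals_Archimedean2 by blast
  then have N0: "N > 0"
    using w by (metis abs_ge_zero divide_nonneg_pos gr0I not_le of_nat_0)
  define v where "v = (\<lambda>k::nat. Complex (Re w) (k * (Im w / N)))"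
  have step: "has_bochner_integral lborel
    (\<lambda>t. indicator {0<..} t *\<^sub>R (of_real (t powr p) * exp (- v k * of_real (t powr \<alpha>))))
    (of_real (Gamma ((p + 1) / \<alpha>) / \<alpha>) * v k powr (- of_real ((p + 1) / \<alpha>)))" if "p > -1" for k p
    using that
  proof (induction k arbitrary: p)
    case 0
    have v0: "v 0 = of_real (Re w)" by (simp add: v_def complex_eq_iff)
    have "has_bochner_integral lborel
        (\<lambda>t. complex_of_real (indicator {0<..} t * (t powr p * exp (- Re w * t powr \<alpha>))))
        (of_real (Gamma ((p + 1) / \<alpha>) / \<alpha> * Re w powr (- ((p + 1) / \<alpha>))))"
      by (rule has_bochner_integral_of_real[OF has_bochner_integral_powr_exp_powr[OF 0 w \<alpha>]])
    moreover have "of_real (Re w powr (- ((p + 1) / \<alpha>))) = v 0 powr (- of_real ((p + 1) / \<alpha>))"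
      using w unfolding v0 by (subst of_real_minus[symmetric], subst powr_of_real) auto
    ultimately show ?case
      unfolding v0 by (simp add: scaleR_conv_of_real flip: exp_of_real)
  next
    case (Suc k)
    have "v (Suc k) = v k + Complex 0 (Im w / N)"
      by (simp add: v_def complex_eq_iff algebra_simps add_divide_distrib)
    moreover have "norm (Complex 0 (Im w / N)) = \<bar>Im w\<bar> / N"
      by (simp add: complex_norm)
    then have "norm (Complex 0 (Im w / N)) < Re (v k)"
      using N N0 w by (simp only: v_def complex.sel) (simp add: field_simps)
    ultimately show ?case
      using has_bochner_integral_powr_exp_step[OF Suc.prems \<alpha> _ Suc.IH] by simp
  qed
  have "v N = w"
    using N0 by (simp add: v_def complex_eq_iff)
  with step[OF p, of N] show ?thesis by (simp only:)
qed

section \<open>Moments of the stable characteristic function\<close>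

text \<open>Reflection carries the second integral to the negative axis; the two open half-lines
  miss only the null set {0}.\<close>

lemma has_bochner_integral_split_at_0:
  fixes f :: "real \<Rightarrow> 'b::{banach, second_countable_topology}"
  assumes [measurable]: "f \<in> borel_measurable borel"
    and pos: "has_bochner_integral lborel (\<lambda>t. indicator {0<..} t *\<^sub>R f t) a"
    and neg: "has_bochner_integral lborel (\<lambda>t. indicator {0<..} t *\<^sub>R f (- t)) b"
  shows "has_bochner_integral lborel f (a + b)"
proof -
  have "has_bochner_integral lborel (\<lambda>t. indicator {0<..} (- t) *\<^sub>R f t) b"
    using neg lborel_integrable_real_affine[of "\<lambda>t. indicator {0<..} t *\<^sub>R f (- t)" "-1" 0]
      lborel_integral_real_affine[of "-1" "\<lambda>t. indicator {0<..} t *\<^sub>R f (- t)" 0]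
    by (simp add: has_bochner_integral_iff)
  from has_bochner_integral_add[OF pos this]
  show ?thesis
  proof (rule has_bochner_integralI_AE)
    show "AE t in lborel. indicator {0<..} t *\<^sub>R f t + indicator {0<..} (- t) *\<^sub>R f t = f t"
      using AE_lborel_singleton[of 0] by eventually_elim (auto simp: indicator_def)
  qed simp
qed

text \<open>The characteristic function of the stable law at time t, with the product
  \<open>t * \<sigma> powr \<alpha>\<close> merged into one scale \<gamma>.\<close>

definition stable_char :: "real \<Rightarrow> real \<Rightarrow> real \<Rightarrow> complex" where
  "stable_char \<alpha> \<gamma> k =
     exp (- of_real (\<gamma> * \<bar>k\<bar> powr \<alpha>) * (1 + \<i> * of_real (tan (\<alpha> * pi / 2) * sgn k)))"

lemma measurable_stable_char [measurable]: "stable_char \<alpha> \<gamma> \<in> borel_measurable borel"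
  unfolding stable_char_def[abs_def] by measurable

lemma norm_stable_char: "norm (stable_char \<alpha> \<gamma> k) = exp (- \<gamma> * \<bar>k\<bar> powr \<alpha>)"
  by (simp add: stable_char_def)

lemma stable_char_minus: "stable_char \<alpha> \<gamma> (- k) = cnj (stable_char \<alpha> \<gamma> k)"
  by (simp add: stable_char_def exp_cnj sgn_minus)

text \<open>The integrand at -t is the conjugate of that at t, so the half-lines contribute Z and
  its conjugate and only 2 Re Z remains. The polar form of the complex rate gives the phase of
  Z.\<close>

lemma has_bochner_integral_stable_char_moment:
  fixes \<alpha> \<gamma> :: real and m :: nat
  assumes \<alpha>: "1 < \<alpha>" "\<alpha> \<le> 2" and \<gamma>: "\<gamma> > 0"
  defines "c \<equiv> - \<gamma> / cos (pi * \<alpha> / 2)"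
  shows "has_bochner_integral lborel (\<lambda>t. (\<i> * of_real t) ^ m * stable_char \<alpha> \<gamma> t)
    (of_real (2 * pi / \<alpha> * (rGamma (1 - real (Suc m) / \<alpha>) * c powr (- (real (Suc m) / \<alpha>)))))"
proof -
  define s where "s = real (Suc m) / \<alpha>"
  have s: "s > 0" using \<alpha> by (simp add: s_def)
  \<comment> \<open>The principal argument of the rate w: the tangent has period \<pi> and cos
    (\<pi>\<alpha>/2) is negative, so the angle \<pi>\<alpha>/2 is shifted by -\<pi>. The modulus of
    w is c.\<close>
  define \<theta> where "\<theta> = pi * (\<alpha> / 2 - 1)"
  have \<theta>: "- pi < \<theta>" "\<theta> \<le> pi"
    using \<alpha> pi_gt_zero mult_nonneg_nonpos[of pi "\<alpha> / 2 - 1"] mult_pos_pos[of pi "\<alpha> / 2"]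
    by (auto simp: \<theta>_def right_diff_distrib)
  have cos_neg: "cos (pi * \<alpha> / 2) < 0"
    by (rule cos_lt_zero_pi) (use \<alpha> in \<open>simp_all add: pos_less_divide_eq\<close>)
  then have c: "c > 0"
    using \<gamma> by (simp add: c_def divide_pos_neg)
  define w where "w = complex_of_real \<gamma> * (1 + \<i> * of_real (tan (\<alpha> * pi / 2)))"
  have w_polar: "w = exp (of_real (ln c) + \<i> * of_real \<theta>)"
  proof -
    have "\<theta> = pi * \<alpha> / 2 - pi"
      by (simp add: \<theta>_def algebra_simps)
    then have "cos \<theta> = - cos (pi * \<alpha> / 2)" "sin \<theta> = - sin (pi * \<alpha> / 2)"
      by (simp_all add: cos_diff sin_diff)
    then have "c * cos \<theta> = \<gamma>" "c * sin \<theta> = \<gamma> * tan (\<alpha> * pi / 2)"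
      using cos_neg by (simp_all add: c_def tan_def mult.commute)
    then have "w = of_real c * cis \<theta>"
      by (simp add: w_def complex_eq_iff)
    then show ?thesis
      using c by (simp add: exp_add cis_conv_exp exp_of_real)
  qed
  have Ln_w: "Ln w = of_real (ln c) + \<i> * of_real \<theta>"
    unfolding w_polar using \<theta> by (intro Ln_exp) auto
  have "w \<noteq> 0" by (simp add: w_polar)
  then have w_powr: "w powr (- of_real s) = of_real (c powr (- s)) * cis (- s * \<theta>)"
    using c by (simp add: powr_def Ln_w cis_conv_exp exp_add[symmetric] algebra_simps
        flip: exp_of_real)
  define Z where "Z = \<i> ^ m * (of_real (Gamma s / \<alpha>) * w powr (- of_real s))"
  have "\<i> ^ m = cis (m * (pi / 2))"
    by (metis cis_pi_half Complex.DeMoivre)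
  then have "Z = of_real (Gamma s / \<alpha> * c powr (- s)) * cis (m * (pi / 2) - s * \<theta>)"
    unfolding Z_def w_powr by (simp add: diff_conv_add_uminus cis_mult[symmetric] mult_ac del: add_uminus_conv_diff)
  \<comment> \<open>By \<alpha> s = m + 1 the dependence on m collapses to a quarter turn, so the
    cosine in Re Z becomes sin (\<pi> s), ready for the reflection formula.\<close>
  also have "m * (pi / 2) - s * \<theta> = pi * s - pi / 2"
    using \<alpha> by (simp add: s_def \<theta>_def field_simps)
  finally have "Re Z = Gamma s * sin (pi * s) / \<alpha> * c powr (- s)"
    by (simp add: cos_diff)
  moreover have "Gamma s * sin (pi * s) = pi * rGamma (1 - s)"
  proof -
    have "complex_of_real (rGamma s * rGamma (1 - s)) = rGamma (of_real s) * rGamma (1 - of_real s)"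
      by (simp add: rGamma_complex_of_real[symmetric])
    also have "\<dots> = sin (of_real pi * of_real s) / of_real pi"
      by (rule rGamma_reflection_complex)
    also have "\<dots> = complex_of_real (sin (pi * s) / pi)"
      by (simp add: sin_of_real[symmetric])
    finally have "rGamma s * rGamma (1 - s) = sin (pi * s) / pi"
      by (simp only: of_real_eq_iff)
    then have "sin (pi * s) = pi * (rGamma s * rGamma (1 - s))"
      by simp
    moreover have "Gamma s * rGamma s = 1"
      using Gamma_real_pos[OF s] by (simp add: rGamma_inverse_Gamma)
    ultimately show ?thesis
      by algebra
  qed
  ultimately have ReZ: "Z + cnj Z = of_real (2 * pi / \<alpha> * (rGamma (1 - s) * c powr (- s)))"
    by (simp add: complex_add_cnj)
  let ?f = "\<lambda>t::real. (\<i> * of_real t) ^ m * stable_char \<alpha> \<gamma> t"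
  have pos: "has_bochner_integral lborel (\<lambda>t. indicator {0<..} t *\<^sub>R ?f t) Z"
  proof -
    have "Re w > 0" using \<gamma> by (simp add: w_def)
    moreover have "(real m + 1) / \<alpha> = s" by (simp add: s_def)
    ultimately have "has_bochner_integral lborel (\<lambda>t. \<i> ^ m * indicator {0<..} t *\<^sub>R
        (of_real (t powr m) * exp (- w * of_real (t powr \<alpha>)))) Z"
      unfolding Z_def using has_bochner_integral_powr_exp_complex[of "real m" \<alpha> w] \<alpha>
      by (intro has_bochner_integral_mult_right) simp
    also have "(\<lambda>t. \<i> ^ m * indicator {0<..} t *\<^sub>R
        (of_real (t powr m) * exp (- w * of_real (t powr \<alpha>)))) = (\<lambda>t. indicator {0<..} t *\<^sub>R ?f t)"
    proof
      fix t :: real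
      show "\<i> ^ m * indicator {0<..} t *\<^sub>R (of_real (t powr m) * exp (- w * of_real (t powr \<alpha>))) =
          indicator {0<..} t *\<^sub>R ?f t"
        by (cases "t > 0")
          (simp_all add: stable_char_def w_def powr_realpow power_mult_distrib mult_ac)
    qed
    finally show ?thesis .
  qed
  have "has_bochner_integral lborel (\<lambda>t. indicator {0<..} t *\<^sub>R ?f (- t)) (cnj Z)"
    using has_bochner_integral_bounded_linear[OF bounded_linear_cnj pos]
    by (simp add: stable_char_minus)
  from has_bochner_integral_split_at_0[OF _ pos this] show ?thesis
    unfolding s_def[symmetric] ReZ by simp
qed

text \<open>As \<alpha> > 1, half of the decay \<gamma> |t|^\<alpha> absorbs the linear growth R |t|
  for large |t|, and the other half is still integrable.\<close>

lemma integrable_exp_stable: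
  fixes \<alpha> \<gamma> R :: real
  assumes \<alpha>: "1 < \<alpha>" and \<gamma>: "\<gamma> > 0" and R: "R \<ge> 0"
  shows "integrable lborel (\<lambda>t. exp (R * \<bar>t\<bar> - \<gamma> * \<bar>t\<bar> powr \<alpha>))"
proof -
  \<comment> \<open>T solves T^(\<alpha>-1) = 2 R / \<gamma>, so R t \<le> (\<gamma>/2) t^\<alpha>
    beyond T; before T the linear term is at most R T.\<close>
  define T where "T = (2 * R / \<gamma>) powr (1 / (\<alpha> - 1))"
  have bound: "R * t - \<gamma> * t powr \<alpha> \<le> R * T + (- (\<gamma> / 2) * t powr \<alpha>)" if t: "t > 0" for t
  proof (cases "t \<le> T")
    case True
    then have "R * t \<le> R * T"
      using R by (rule mult_left_mono)
    moreover have "0 \<le> \<gamma> / 2 * t powr \<alpha>" using \<gamma> by simp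
    ultimately show ?thesis by (simp add: field_simps)
  next
    case False
    have "2 * R / \<gamma> = T powr (\<alpha> - 1)"
      using \<alpha> R \<gamma> by (simp add: T_def powr_powr)
    also have "\<dots> \<le> t powr (\<alpha> - 1)"
      using False \<alpha> by (intro powr_mono2) (auto simp: T_def)
    finally have "R * t \<le> \<gamma> / 2 * (t powr (\<alpha> - 1) * t)"
      using \<gamma> t by (simp add: field_simps)
    also have "t powr (\<alpha> - 1) * t = t powr \<alpha>"
      using t by (simp add: powr_diff)
    finally have "R * t - \<gamma> * t powr \<alpha> \<le> - (\<gamma> / 2) * t powr \<alpha>"
      by (simp add: field_simps)
    moreover have "0 \<le> R * T" using R by (simp add: T_def)
    ultimately show ?thesis by linarith
  qed
  let ?f = "\<lambda>t. exp (R * \<bar>t\<bar> - \<gamma> * \<bar>t\<bar> powr \<alpha>)"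
  have half: "integrable lborel (\<lambda>t. indicator {0<..} t *\<^sub>R ?f t)"
  proof (rule Bochner_Integration.integrable_bound)
    \<comment> \<open>The factor \<open>t powr 0\<close> is 1 on the positive axis and only matches
      the Gamma integral at p = 0.\<close>
    show "integrable lborel (\<lambda>t. exp (R * T) * (indicator {0<..} t * (t powr 0 * exp (- (\<gamma> / 2) * t powr \<alpha>))))"
      using has_bochner_integral_powr_exp_powr[of 0 "\<gamma> / 2" \<alpha>] \<alpha> \<gamma>
      by (intro integrable_mult_right) (simp add: has_bochner_integral_iff)
    show "AE t in lborel. norm (indicator {0<..} t *\<^sub>R ?f t) \<le>
        norm (exp (R * T) * (indicator {0<..} t * (t powr 0 * exp (- (\<gamma> / 2) * t powr \<alpha>))))"
    proof (rule AE_I2)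
      fix t :: real
      show "norm (indicator {0<..} t *\<^sub>R ?f t) \<le>
          norm (exp (R * T) * (indicator {0<..} t * (t powr 0 * exp (- (\<gamma> / 2) * t powr \<alpha>))))"
        using bound[of t] by (cases "t > 0") (simp_all add: exp_add[symmetric])
    qed
  qed auto
  have "has_bochner_integral lborel ?f (integral\<^sup>L lborel (\<lambda>t. indicator {0<..} t *\<^sub>R ?f t) +
      integral\<^sup>L lborel (\<lambda>t. indicator {0<..} t *\<^sub>R ?f (- t)))"
    using half by (intro has_bochner_integral_split_at_0 has_bochner_integral_integrable) simp_all
  then show ?thesis
    by (simp add: has_bochner_integral_iff)
qed

section \<open>Levy inversion for integrable characteristic functions\<close>

lemma norm_iexp_diff_le: "norm (iexp x - iexp y) \<le> \<bar>x - y\<bar>"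
proof -
  have "iexp x - iexp y = iexp y * (iexp (x - y) - 1)"
    by (simp add: right_diff_distrib exp_add[symmetric])
  then have "norm (iexp x - iexp y) = norm (iexp (x - y) - 1)"
    by (simp add: norm_mult)
  also have "\<dots> \<le> \<bar>x - y\<bar>"
    using iexp_approx1[of "x - y" 0] by simp
  finally show ?thesis .
qed

text \<open>The integrand of Levy's inversion formula. Division by zero gives it the value 0 at t =
  0 instead of the limit (b - a) \<phi>(0), which does not affect integrals.\<close>

definition levy_kernel :: "real \<Rightarrow> real \<Rightarrow> (real \<Rightarrow> complex) \<Rightarrow> real \<Rightarrow> complex" where
  "levy_kernel a b \<phi> t = (iexp (- (t * a)) - iexp (- (t * b))) / (\<i> * of_real t) * \<phi> t"

lemma norm_levy_kernel_le: "norm (levy_kernel a b \<phi> t) \<le> \<bar>b - a\<bar> * norm (\<phi> t)"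
proof (cases "t = 0")
  case False
  have "norm (iexp (- (t * a)) - iexp (- (t * b))) \<le> \<bar>t\<bar> * \<bar>b - a\<bar>"
    using norm_iexp_diff_le[of "- (t * a)" "- (t * b)"]
    by (simp add: abs_mult[symmetric] algebra_simps)
  then have "norm ((iexp (- (t * a)) - iexp (- (t * b))) / (\<i> * of_real t)) \<le> \<bar>b - a\<bar>"
    using False by (simp add: norm_divide norm_mult divide_le_eq mult.commute)
  then show ?thesis
    unfolding levy_kernel_def norm_mult by (rule mult_right_mono) simp
qed (simp add: levy_kernel_def)

lemma integrable_levy_kernel:
  assumes "integrable lborel \<phi>"
  shows "integrable lborel (levy_kernel a b \<phi>)"
proof (rule Bochner_Integration.integrable_bound)
  show "integrable lborel (\<lambda>t. \<bar>b - a\<bar> * norm (\<phi> t))"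
    using assms by (intro integrable_mult_right integrable_norm)
  show "AE t in lborel. norm (levy_kernel a b \<phi> t) \<le> norm (\<bar>b - a\<bar> * norm (\<phi> t))"
    using norm_levy_kernel_le[of a b \<phi>] by (intro AE_I2) (simp add: abs_mult)
  have [measurable]: "\<phi> \<in> borel_measurable borel"
    using assms by auto
  show "levy_kernel a b \<phi> \<in> borel_measurable lborel"
    unfolding levy_kernel_def[abs_def] by measurable
qed

context real_distribution
begin

text \<open>The general formula is a limit of integrals over (-n, n); an integrable kernel dominates
  its own truncations, so the limit is the full integral.\<close>

lemma Levy_Inversion_integrable:
  assumes ab: "a \<le> b" "measure M {a} = 0" "measure M {b} = 0"
    and int: "integrable lborel (char M)"
  shows "of_real (measure M {a<..b}) = 1 / (2 * pi) * (CLBINT t. levy_kernel a b (char M) t)"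
proof -
  let ?K = "levy_kernel a b (char M)"
  have K: "integrable lborel ?K"
    by (rule integrable_levy_kernel[OF int])
  have "(\<lambda>n. CLBINT t. indicator {- real n<..<real n} t *\<^sub>R ?K t) \<longlonglongrightarrow> (CLBINT t. ?K t)"
  proof (rule integral_dominated_convergence[where w = "\<lambda>t. norm (?K t)"])
    show "AE t in lborel. (\<lambda>n. indicator {- real n<..<real n} t *\<^sub>R ?K t) \<longlonglongrightarrow> ?K t"
    proof (rule AE_I2, rule tendsto_eventually)
      fix t :: real
      obtain N :: nat where "\<bar>t\<bar> < N" using reals_Archimedean2 by blast
      then show "\<forall>\<^sub>F n in sequentially. indicator {- real n<..<real n} t *\<^sub>R ?K t = ?K t"
        by (intro eventually_sequentiallyI[of N]) (auto simp: indicator_def)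
    qed
    show "AE t in lborel. norm (indicator {- real n<..<real n} t *\<^sub>R ?K t) \<le> norm (?K t)" for n
      by (rule AE_I2) (simp add: indicator_def)
  qed (use K in auto)
  moreover have "(CLBINT t. indicator {- real n<..<real n} t *\<^sub>R ?K t) =
      (CLBINT t=-real n..real n. (iexp (- (t * a)) - iexp (- (t * b))) / (\<i> * t) * char M t)" for n
    by (simp add: interval_lebesgue_integral_def set_lebesgue_integral_def levy_kernel_def)
  ultimately have "(\<lambda>n. 1 / (2 * pi) *
      (CLBINT t=-real n..real n. (iexp (- (t * a)) - iexp (- (t * b))) / (\<i> * t) * char M t))
      \<longlonglongrightarrow> 1 / (2 * pi) * (CLBINT t. ?K t)"
    by (intro tendsto_mult_left) simp
  with Levy_Inversion[OF ab] show ?thesis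
    by (intro LIMSEQ_unique) auto
qed

text \<open>Inversion bounds the mass of an interval with atom-free endpoints by a constant times
  its length. Atoms are countable, so such intervals shrink to any point x and force its mass to
  0.\<close>

lemma no_atom_if_char_integrable:
  assumes int: "integrable lborel (char M)"
  shows "measure M {x} = 0"
proof (rule ccontr)
  assume "measure M {x} \<noteq> 0"
  then have pos: "measure M {x} > 0" by (simp add: measure_nonneg less_le)
  define C where "C = (LBINT t. norm (char M t)) / (2 * pi)"
  have C: "C \<ge> 0" by (simp add: C_def)
  have le: "measure M {a<..b} \<le> (b - a) * C"
    if ab: "a \<le> b" "measure M {a} = 0" "measure M {b} = 0" for a b
  proof -
    have "measure M {a<..b} = norm (1 / (2 * pi) * (CLBINT t. levy_kernel a b (char M) t))"
      by (subst Levy_Inversion_integrable[OF ab int, symmetric]) simp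
    also have "\<dots> = norm (CLBINT t. levy_kernel a b (char M) t) / (2 * pi)"
      by (simp add: norm_mult norm_divide)
    also have "\<dots> \<le> (LBINT t. norm (levy_kernel a b (char M) t)) / (2 * pi)"
      by (intro divide_right_mono integral_norm_bound) simp
    also have "\<dots> \<le> (LBINT t. \<bar>b - a\<bar> * norm (char M t)) / (2 * pi)"
      using int integrable_levy_kernel[OF int]
      by (intro divide_right_mono integral_mono integrable_norm integrable_mult_right norm_levy_kernel_le) auto
    also have "\<dots> = (b - a) * C"
      using ab by (simp add: C_def)
    finally show ?thesis .
  qed
  \<comment> \<open>An interval of length below 2 e then has mass at most 2 e C, which is C / (C +
    1) times the mass of x; the added 1 also covers C = 0.\<close>
  define e where "e = measure M {x} / (2 * (C + 1))"
  have e: "e > 0" using pos C by (simp add: e_def)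
  have "\<exists>y\<in>{l<..<u}. measure M {y} = 0" if "l < u" for l u
  proof (rule ccontr)
    assume "\<not> ?thesis"
    then have "{l<..<u} \<subseteq> {y. measure M {y} \<noteq> 0}" by auto
    then have "countable {l<..<u}"
      using countable_support countable_subset by blast
    then show False
      using uncountable_open_interval[of l u] that by simp
  qed
  from this[of "x - e" x] this[of x "x + e"] e
  obtain a b where ab: "x - e < a" "a < x" "measure M {a} = 0" "x < b" "b < x + e" "measure M {b} = 0"
    by auto
  have "measure M {x} \<le> measure M {a<..b}"
    using ab by (intro finite_measure_mono) auto
  also have "\<dots> \<le> (b - a) * C"
    using ab by (intro le) auto
  also have "\<dots> \<le> (2 * e) * C"
    using ab C by (intro mult_right_mono) auto
  also have "\<dots> < measure M {x}"
    using pos C by (simp add: e_def field_simps)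
  finally show False by simp
qed

end

section \<open>Series for interval probabilities of the stable law\<close>

lemma levy_kernel_power_series:
  assumes "t \<noteq> 0"
  shows "(\<lambda>m. of_real (((- a) ^ Suc m - (- b) ^ Suc m) / fact (Suc m)) * ((\<i> * of_real t) ^ m * \<phi> t))
    sums levy_kernel a b \<phi> t"
proof -
  have exp_series: "(\<lambda>n. (- of_real x * (\<i> * of_real t)) ^ n / fact n) sums iexp (- (t * x))" for x :: real
    using exp_converges[of "- of_real x * (\<i> * complex_of_real t)"]
    by (simp add: scaleR_conv_of_real field_simps)
  let ?d = "\<lambda>n. (- of_real a * (\<i> * of_real t)) ^ n / fact n - (- of_real b * (\<i> * of_real t)) ^ n / fact n"
  have "?d sums (iexp (- (t * a)) - iexp (- (t * b)))"
    by (intro sums_diff exp_series)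
  \<comment> \<open>The constant terms of the two exponentials cancel, so the sum may start at index
    1 and every remaining term is divisible by i t.\<close>
  then have "(\<lambda>m. ?d (Suc m)) sums (iexp (- (t * a)) - iexp (- (t * b)))"
    by (subst sums_Suc_iff) simp
  then have "(\<lambda>m. ?d (Suc m) * (\<phi> t / (\<i> * of_real t))) sums
      ((iexp (- (t * a)) - iexp (- (t * b))) * (\<phi> t / (\<i> * of_real t)))"
    by (rule sums_mult2)
  moreover have "?d (Suc m) * (\<phi> t / (\<i> * of_real t)) =
      of_real (((- a) ^ Suc m - (- b) ^ Suc m) / fact (Suc m)) * ((\<i> * of_real t) ^ m * \<phi> t)" for m
  proof -
    have "?d (Suc m) = of_real (((- a) ^ Suc m - (- b) ^ Suc m) / fact (Suc m)) * (\<i> * of_real t) ^ Suc m"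
      by (simp only: power_mult_distrib of_real_divide of_real_diff of_real_power of_real_minus
          of_real_fact diff_divide_distrib left_diff_distrib times_divide_eq_left)
    then show ?thesis using assms by simp
  qed
  ultimately show ?thesis
    by (simp only: levy_kernel_def times_divide_eq_right times_divide_eq_left)
qed


text \<open>Exchanging sum and integral rests on one majorant, 2 R exp (R |t| - \<gamma>
  |t|^\<alpha>): factorial decay of the coefficients gives the growing factor, the characteristic
  function the decaying one.\<close>

lemma stable_distribution_series:
  fixes \<alpha> \<gamma> a b :: real
  assumes \<alpha>: "1 < \<alpha>" "\<alpha> \<le> 2" and \<gamma>: "\<gamma> > 0"
    and M: "real_distribution M" "char M = stable_char \<alpha> \<gamma>" and ab: "a \<le> b"
  defines "c \<equiv> - \<gamma> / cos (pi * \<alpha> / 2)"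
  shows "(\<lambda>n. 1 / fact n * rGamma (1 - real n / \<alpha>) * ((- a) ^ n - (- b) ^ n) * c powr (- (real n / \<alpha>)))
    sums (\<alpha> * measure M {a<..b})"
proof -
  interpret real_distribution M by fact
  let ?\<phi> = "stable_char \<alpha> \<gamma>"
  note moment = has_bochner_integral_stable_char_moment[OF \<alpha> \<gamma>, folded c_def]
  have int: "integrable lborel ?\<phi>"
    using moment[of 0] by (simp add: has_bochner_integral_iff)
  define D where "D = (\<lambda>m. ((- a) ^ Suc m - (- b) ^ Suc m) / fact (Suc m))"
  define q where "q = (\<lambda>n. rGamma (1 - real n / \<alpha>) * c powr (- (real n / \<alpha>)))"
  define R where "R = max \<bar>a\<bar> \<bar>b\<bar>"
  have R: "R \<ge> 0" by (simp add: R_def)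
  \<comment> \<open>One factor R is set aside and (m + 1)! is weakened to m!, so that the bounds
    times |t|^m sum to an exponential.\<close>
  have D_le: "\<bar>D m\<bar> \<le> 2 * R * (R ^ m / fact m)" for m
  proof -
    have "\<bar>(- a) ^ Suc m - (- b) ^ Suc m\<bar> \<le> \<bar>a\<bar> ^ Suc m + \<bar>b\<bar> ^ Suc m"
      by (rule order_trans[OF abs_triangle_ineq4]) (simp add: power_abs abs_mult)
    also have "\<dots> \<le> R ^ Suc m + R ^ Suc m"
      by (intro add_mono power_mono) (auto simp: R_def)
    finally have "\<bar>D m\<bar> \<le> 2 * R ^ Suc m / fact (Suc m)"
      by (simp add: D_def abs_divide divide_right_mono)
    also have "\<dots> \<le> 2 * R ^ Suc m / fact m"
      using R by (intro divide_left_mono fact_mono) auto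
    finally show ?thesis by simp
  qed
  have "(\<lambda>m. CLBINT t. of_real (D m) * ((\<i> * of_real t) ^ m * ?\<phi> t)) sums
      (CLBINT t. levy_kernel a b ?\<phi> t)"
  proof (rule sums_integral_dominated(2))
    show "integrable lborel (\<lambda>t. 2 * R * exp (R * \<bar>t\<bar> - \<gamma> * \<bar>t\<bar> powr \<alpha>))"
      using integrable_exp_stable[OF \<alpha>(1) \<gamma> R] by (rule integrable_mult_right)
    fix N and t :: real
    have "(\<Sum>m<N. norm (of_real (D m) * ((\<i> * of_real t) ^ m * ?\<phi> t))) \<le>
        (\<Sum>m<N. 2 * R * exp (- \<gamma> * \<bar>t\<bar> powr \<alpha>) * ((R * \<bar>t\<bar>) ^ m / fact m))"
    proof (rule sum_mono)
      fix m
      have "norm (of_real (D m) * ((\<i> * of_real t) ^ m * ?\<phi> t)) =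
          \<bar>D m\<bar> * (\<bar>t\<bar> ^ m * exp (- \<gamma> * \<bar>t\<bar> powr \<alpha>))"
        by (simp add: norm_mult norm_power norm_stable_char)
      also have "\<dots> \<le> 2 * R * (R ^ m / fact m) * (\<bar>t\<bar> ^ m * exp (- \<gamma> * \<bar>t\<bar> powr \<alpha>))"
        by (intro mult_right_mono D_le) simp
      also have "\<dots> = 2 * R * exp (- \<gamma> * \<bar>t\<bar> powr \<alpha>) * ((R * \<bar>t\<bar>) ^ m / fact m)"
        by (simp add: power_mult_distrib)
      finally show "norm (of_real (D m) * ((\<i> * of_real t) ^ m * ?\<phi> t)) \<le>
          2 * R * exp (- \<gamma> * \<bar>t\<bar> powr \<alpha>) * ((R * \<bar>t\<bar>) ^ m / fact m)" .
    qed
    also have "\<dots> \<le> 2 * R * exp (- \<gamma> * \<bar>t\<bar> powr \<alpha>) * exp (R * \<bar>t\<bar>)"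
      unfolding sum_distrib_left[symmetric]
      using R by (intro mult_left_mono sum_power_fact_le_exp) auto
    also have "\<dots> = 2 * R * exp (R * \<bar>t\<bar> - \<gamma> * \<bar>t\<bar> powr \<alpha>)"
      by (simp add: exp_diff exp_minus divide_inverse)
    finally show "(\<Sum>m<N. norm (of_real (D m) * ((\<i> * of_real t) ^ m * ?\<phi> t))) \<le>
        2 * R * exp (R * \<bar>t\<bar> - \<gamma> * \<bar>t\<bar> powr \<alpha>)" .
  next
    \<comment> \<open>At t = 0 the kernel has its default value 0 rather than the sum of the series,
      hence only almost everywhere.\<close>
    show "AE t in lborel. (\<lambda>m. of_real (D m) * ((\<i> * of_real t) ^ m * ?\<phi> t)) sums levy_kernel a b ?\<phi> t"
      using AE_lborel_singleton[of 0]
      by eventually_elim (unfold D_def, rule levy_kernel_power_series)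
    show "levy_kernel a b ?\<phi> \<in> borel_measurable lborel"
      using integrable_levy_kernel[OF int] by (rule borel_measurable_integrable)
  qed simp
  moreover have "(CLBINT t. of_real (D m) * ((\<i> * of_real t) ^ m * ?\<phi> t)) =
      of_real (D m * (2 * pi / \<alpha> * q (Suc m)))" for m
    using has_bochner_integral_integral_eq[OF has_bochner_integral_mult_right[OF moment[of m], of "of_real (D m)"]]
    by (simp only: q_def of_real_mult)
  moreover have "(CLBINT t. levy_kernel a b ?\<phi> t) = of_real (2 * pi * measure M {a<..b})"
    using Levy_Inversion_integrable[OF ab] no_atom_if_char_integrable int
    unfolding M(2) by (simp add: field_simps)
  ultimately have "(\<lambda>m. complex_of_real (D m * (2 * pi / \<alpha> * q (Suc m)))) sums
      of_real (2 * pi * measure M {a<..b})"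
    by (simp only:)
  then have "(\<lambda>m. D m * (2 * pi / \<alpha> * q (Suc m))) sums (2 * pi * measure M {a<..b})"
    by (simp only: sums_of_real_iff)
  from sums_mult[OF this, of "\<alpha> / (2 * pi)"]
  have "(\<lambda>m. D m * q (Suc m)) sums (\<alpha> * measure M {a<..b})"
    using \<alpha> by (simp add: field_simps)
  moreover define h where
    "h n = 1 / fact n * rGamma (1 - real n / \<alpha>) * ((- a) ^ n - (- b) ^ n) * c powr (- (real n / \<alpha>))" for n
  have "D m * q (Suc m) = h (Suc m)" for m
    by (simp only: D_def q_def h_def) (simp only: divide_inverse mult_ac mult_1_left)
  \<comment> \<open>With 0^0 = 1 both zeroth powers are 1 and cancel, so prepending the term n = 0
    leaves the sum unchanged.\<close>
  moreover have "h 0 = 0" by (simp add: h_def)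
  ultimately show ?thesis
    using sums_Suc_iff[of h] unfolding h_def[symmetric] by simp
qed

section \<open>From the option payoff to an interval probability\<close>

theorem proposition4:
  fixes \<alpha> \<sigma> u S Kp Km r \<tau> :: real
    and M :: "'a measure" and X :: "real \<Rightarrow> 'a \<Rightarrow> real"
  assumes "1 < \<alpha>" "\<alpha> \<le> 2" "\<sigma> > 0" "u > 0" "S > 0" "0 < Km" "Km < Kp" "\<tau> > 0"
    and "spectrally_negative_stable M \<alpha> \<sigma> X"
  defines "\<mu> \<equiv> stable_mu \<alpha> \<sigma>"
    and "kp \<equiv> log_moneyness u S Kp r \<tau>"
    and "km \<equiv> log_moneyness u S Km r \<tau>"
  shows "summable (capped_CN_series_term \<alpha> \<mu> \<tau> kp km) \<and>
    option_value M X (capped_power_CN_payoff u) S Kp Km r \<mu> \<tau> =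
      exp (- r * \<tau>) / \<alpha> * (\<Sum>n. capped_CN_series_term \<alpha> \<mu> \<tau> kp km n)"
proof -
  have X [measurable]: "X \<tau> \<in> borel_measurable M" and "prob_space M"
    using assms by (auto simp: spectrally_negative_stable_def levy_process_def)
  then interpret prob_space M by simp
  define \<gamma> where "\<gamma> = \<tau> * \<sigma> powr \<alpha>"
  have \<gamma>: "\<gamma> > 0" using assms by (simp add: \<gamma>_def)
  let ?D = "distr M borel (X \<tau>)"
  have D: "real_distribution ?D"
    by (rule real_distribution_distr[OF X])
  then interpret D: real_distribution ?D .
  have char: "char ?D = stable_char \<alpha> \<gamma>"
  proof
    fix k
    show "char ?D k = stable_char \<alpha> \<gamma> k"
      using assms unfolding spectrally_negative_stable_def stable_char_def \<gamma>_def by simp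
  qed
  \<comment> \<open>The smaller strike has the larger log-moneyness, so negation makes a the lower
    endpoint; -a and -b are the bases of the powers in the series.\<close>
  define a where "a = - (km + \<mu> * \<tau>)"
  define b where "b = - (kp + \<mu> * \<tau>)"
  have log_moneyness: "log_moneyness u S K r \<tau> = ln S - ln K / u + r * \<tau>" if "K > 0" for K
    using that assms by (simp add: log_moneyness_def ln_div ln_powr)
  have a_eq: "a = ln Km / u - ln S - (r + \<mu>) * \<tau>" and b_eq: "b = ln Kp / u - ln S - (r + \<mu>) * \<tau>"
    using assms by (simp_all add: a_def b_def kp_def km_def log_moneyness algebra_simps)
  have "ln Km / u < ln Kp / u"
    using assms by (intro divide_strict_right_mono) auto
  then have ab: "a < b"
    by (simp add: a_eq b_eq)
  have payoff: "capped_power_CN_payoff u (asset_price X S r \<mu> \<tau> \<omega>) Kp Km = indicator {a<..<b} (X \<tau> \<omega>)" for \<omega>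
  proof -
    let ?s = "asset_price X S r \<mu> \<tau> \<omega> powr u"
    have s: "?s > 0" and ln_s: "ln ?s = u * (ln S + ((r + \<mu>) * \<tau> + X \<tau> \<omega>))"
      using assms by (simp_all add: asset_price_def ln_powr ln_mult)
    have "Km < ?s \<longleftrightarrow> ln Km < ln ?s"
      using s assms by (intro ln_less_cancel_iff[symmetric]) auto
    also have "\<dots> \<longleftrightarrow> a < X \<tau> \<omega>"
      unfolding ln_s a_eq using assms by (simp add: less_diff_eq diff_less_eq pos_divide_less_eq field_simps)
    finally have 1: "Km < ?s \<longleftrightarrow> a < X \<tau> \<omega>" .
    have "?s < Kp \<longleftrightarrow> ln ?s < ln Kp"
      using s assms by (intro ln_less_cancel_iff[symmetric]) auto
    also have "\<dots> \<longleftrightarrow> X \<tau> \<omega> < b"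
      unfolding ln_s b_eq using assms by (simp add: field_simps)
    finally show ?thesis
      using 1 by (simp add: capped_power_CN_payoff_def indicator_def)
  qed
  have "(\<integral>\<omega>. capped_power_CN_payoff u (asset_price X S r \<mu> \<tau> \<omega>) Kp Km \<partial>M) = measure ?D {a<..<b}"
    using integral_distr[OF X, of "indicator {a<..<b} :: real \<Rightarrow> real"] by (simp add: payoff)
  \<comment> \<open>The payoff excludes both strikes, whereas inversion measures a half-open
    interval; they agree because b is not an atom.\<close>
  also have "measure ?D {a<..<b} = measure ?D {a<..b}"
  proof -
    have "integrable lborel (char ?D)"
      unfolding char using has_bochner_integral_stable_char_moment[of \<alpha> \<gamma> 0] assms \<gamma>
      by (simp add: has_bochner_integral_iff)
    then have "measure ?D {b} = 0"
      by (rule D.no_atom_if_char_integrable)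
    moreover have "{a<..b} = {a<..<b} \<union> {b}" using ab by auto
    ultimately show ?thesis
      using D.finite_measure_Union[of "{a<..<b}" "{b}"] by simp
  qed
  finally have price: "option_value M X (capped_power_CN_payoff u) S Kp Km r \<mu> \<tau> =
      exp (- r * \<tau>) * measure ?D {a<..b}"
    by (simp add: option_value_def)
  \<comment> \<open>This identifies the modulus c of the complex rate with - \<mu> \<tau>, the base
    of the fractional powers in the pricing series.\<close>
  have "- \<gamma> / cos (pi * \<alpha> / 2) = - \<mu> * \<tau>"
    by (simp add: \<gamma>_def \<mu>_def stable_mu_def)
  then have "capped_CN_series_term \<alpha> \<mu> \<tau> kp km sums (\<alpha> * measure ?D {a<..b})"
    using stable_distribution_series[OF assms(1,2) \<gamma> D char less_imp_le[OF ab]]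
    unfolding capped_CN_series_term_def[abs_def] a_def b_def by (simp only: minus_minus)
  then show ?thesis
    using assms(1) by (simp add: price sums_iff)
qed

end
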